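(* Let $k>0$ be real and let $\lambda,\alpha,\beta,\gamma,\delta\in\mathbb{C}$. The following generating relations in the variables $x,y,t$ hold. (i) If $\beta,\delta\notin\{0,-k,-2k,\dots\}$, then $$\sum_{n=0}^\infty\frac{(\lambda)_{n,k}}{n!}\,{}_2F_{1,k}\left[\begin{array}{c}\lambda+nk,\ \alpha\\ \beta\end{array};x\right]{}_2F_{1,k}\left[\begin{array}{c}\lambda+nk,\ \gamma\\ \delta\end{array};y\right]t^n$$ $$=(1-kt)^{-\frac{\lambda}{k}}\sum_{n=0}^\infty\frac{(\lambda)_{n,k}(\alpha)_{n,k}(\gamma)_{n,k}}{(\beta)_{n,k}(\delta)_{n,k}\,n!}\left(\frac{k^{3}xyt}{(1-kt)^2}\right)^n{}_2F_{1,k}\left[\begin{array}{c}\lambda+nk,\ \alpha+nk\\ \beta+nk\end{array};\frac{x}{1-kt}\right]{}_2F_{1,k}\left[\begin{array}{c}\lambda+nk,\ \gamma+nk\\ \delta+nk\end{array};\frac{y}{1-kt}\right].$$ (ii) In the special case $\beta=\delta=\lambda$, with $\lambda\notin\{0,-k,-2k,\dots\}$, $$\sum_{n=0}^\infty\frac{(\lambda)_{n,k}}{n!}\,{}_2F_{1,k}\left[\begin{array}{c}\lambda+nk,\ \alpha\\ \lambda\end{array};x\right]{}_2F_{1,k}\left[\begin{array}{c}\lambda+nk,\ \gamma\\ \lambda\end{array};y\right]t^n$$ $$=(1-kt)^{\frac{\gamma+\alpha-\lambda}{k}}(1-kt-kx)^{-\frac{\alpha}{k}}(1-kt-ky)^{-\frac{\gamma}{k}}\,{}_2F_{1,k}\left[\begin{array}{c}\alpha,\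 \gamma\\ \lambda\end{array};\frac{k^{3}xyt}{(1-kt-kx)(1-kt-ky)}\right].$$
   Context: For real $k>0$, $a\in\mathbb{C}$ and an integer $n\ge 1$, the Pochhammer $k$-symbol is $(a)_{n,k}=a(a+k)(a+2k)\cdots(a+(n-1)k)$, and $(a)_{0,k}=1$. The $k$-hypergeometric function is $${}_2F_{1,k}\left[\begin{array}{c}\alpha,\ \beta\\ \gamma\end{array};x\right]=\sum_{n=0}^\infty\frac{(\alpha)_{n,k}(\beta)_{n,k}}{(\gamma)_{n,k}}\frac{x^n}{n!},$$ with $\gamma$ such that no denominator vanishes.
   Formalization: The factor k^3 in the arguments of (i) and (ii) is corrected to k^2 (k^3 fails for k≠1: compare coefficients of xyt), and the relations are stated for k|x|<1, k|y|<1, k|t|<(1-k|x|)(1-k|y|), with principal powers, since no domain is given. *)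

theory Defs
  imports "HOL-Analysis.Analysis"
begin

definition kpoch :: "real \<Rightarrow> complex \<Rightarrow> nat \<Rightarrow> complex" where
  "kpoch k a n = (\<Prod>i<n. a + of_nat i * of_real k)"

definition khyp_term :: "real \<Rightarrow> complex \<Rightarrow> complex \<Rightarrow> complex \<Rightarrow> complex \<Rightarrow> nat \<Rightarrow> complex" where
  "khyp_term k \<alpha> \<beta> \<gamma> x n = kpoch k \<alpha> n * kpoch k \<beta> n / kpoch k \<gamma> n * (x ^ n / fact n)"

(* Meaningful only if \<gamma> is not in {0, -k, -2k, ...} (otherwise division by zero
   yields zero terms) and the series converges, for which k * norm x < 1 suffices. *)
definition khyp :: "real \<Rightarrow> complex \<Rightarrow> complex \<Rightarrow> complex \<Rightarrow> complex \<Rightarrow> complex" where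
  "khyp k \<alpha> \<beta> \<gamma> x = (\<Sum>n. khyp_term k \<alpha> \<beta> \<gamma> x n)"

lemma kpoch_0 [simp]: "kpoch k a 0 = 1"
  by (simp add: kpoch_def)

lemma kpoch_Suc: "kpoch k a (Suc n) = kpoch k a n * (a + of_nat n * of_real k)"
  by (simp add: kpoch_def)

(* By this lemma khyp k \<alpha> \<beta> \<gamma> x is the ordinary 2F1(\<alpha>/k, \<beta>/k; \<gamma>/k; k * x).  Rescaling the
   classical generating relations accordingly, the product (k * x) * (k * y) * (k * t)
   loses one factor k to the quotient of three k-symbols by two in the double series (and
   to the rescaled argument of khyp in its closed form).  The correct coefficient of
   x * y * t is therefore k^2.  The source prints k^3, which is false for k \<noteq> 1. *)
lemma kpoch_eq_pochhammer:
  assumes "k > 0"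
  shows "kpoch k a n = of_real k ^ n * pochhammer (a / of_real k) n"
proof (induction n)
  case (Suc n)
  have "of_real k * (a / of_real k + of_nat n) = a + of_nat n * (of_real k :: complex)"
    using assms by (simp add: distrib_left mult.commute)
  then show ?case
    by (simp add: kpoch_Suc pochhammer_Suc Suc)
qed simp

lemma khyp_summable:
  assumes k: "k > 0" and x: "k * norm x < 1"
  shows "summable (khyp_term k \<alpha> \<beta> \<gamma> x)"
proof -
  define K :: complex where "K = of_real k"
  have K0: "K \<noteq> 0" using k by (simp add: K_def)
  define r :: "nat \<Rightarrow> complex" where
    "r n = (\<alpha> + of_nat n * K) * (\<beta> + of_nat n * K) / ((\<gamma> + of_nat n * K) * of_nat (Suc n)) * x" for n
  have step: "khyp_term k \<alpha> \<beta> \<gamma> x (Suc n) = r n * khyp_term k \<alpha> \<beta> \<gamma> x n" for n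
    unfolding khyp_term_def kpoch_Suc r_def K_def[symmetric] fact_Suc power_Suc of_nat_mult
    by (simp only: mult_ac divide_inverse inverse_mult_distrib)
  define i :: "nat \<Rightarrow> complex" where "i n = inverse (of_nat n)" for n
  have i: "i \<longlonglongrightarrow> 0"
    unfolding i_def by (rule lim_inverse_n)
  have "(\<lambda>n. (\<alpha> * i n + K) * (\<beta> * i n + K) / ((\<gamma> * i n + K) * (1 + i n)) * x)
          \<longlonglongrightarrow> (\<alpha> * 0 + K) * (\<beta> * 0 + K) / ((\<gamma> * 0 + K) * (1 + 0)) * x"
    by (intro tendsto_intros i) (use K0 in auto)
  moreover have "\<forall>\<^sub>F n in sequentially.
      (\<alpha> * i n + K) * (\<beta> * i n + K) / ((\<gamma> * i n + K) * (1 + i n)) * x = r n"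
  proof (rule eventually_mono[OF eventually_gt_at_top[of 0]])
    fix n :: nat assume "n > 0"
    then have n: "of_nat n \<noteq> (0 :: complex)" by simp
    have e: "c * i n + K = (c + of_nat n * K) / of_nat n" for c
      using n by (simp add: i_def field_simps)
    have e1: "1 + i n = of_nat (Suc n) / of_nat n"
      using n by (simp add: i_def field_simps)
    show "(\<alpha> * i n + K) * (\<beta> * i n + K) / ((\<gamma> * i n + K) * (1 + i n)) * x = r n"
      unfolding e e1 r_def using n by simp
  qed
  ultimately have "r \<longlonglongrightarrow> (\<alpha> * 0 + K) * (\<beta> * 0 + K) / ((\<gamma> * 0 + K) * (1 + 0)) * x"
    by (rule Lim_transform_eventually)
  then have "r \<longlonglongrightarrow> K * x" using K0 by simp
  then have "(\<lambda>n. norm (r n)) \<longlonglongrightarrow> k * norm x"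
    using tendsto_norm[of r "K * x" sequentially] k by (simp add: K_def norm_mult)
  moreover obtain c where c: "k * norm x < c" "c < 1"
    using dense[OF x] by blast
  ultimately have "\<forall>\<^sub>F n in sequentially. norm (r n) < c"
    by (auto intro: order_tendstoD)
  then obtain N where N: "\<And>n. n \<ge> N \<Longrightarrow> norm (r n) < c"
    by (auto simp: eventually_at_top_linorder)
  show ?thesis
  proof (rule summable_ratio_test[OF c(2)])
    fix n assume "n \<ge> N"
    then show "norm (khyp_term k \<alpha> \<beta> \<gamma> x (Suc n)) \<le> c * norm (khyp_term k \<alpha> \<beta> \<gamma> x n)"
      unfolding step norm_mult using N[of n] by (intro mult_right_mono) auto
  qed
qed

(* Region of absolute convergence of the double and triple power series in x, y, t
   behind the generating relations.  The lemmas below check that on it all bases of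
   complex powers lie in the open right half plane (so the principal branch is the
   intended one) and that all hypergeometric arguments z satisfy k * norm z < 1. *)
definition conv_region :: "real \<Rightarrow> complex \<Rightarrow> complex \<Rightarrow> complex \<Rightarrow> bool" where
  "conv_region k x y t \<longleftrightarrow>
     k * norm x < 1 \<and> k * norm y < 1 \<and> k * norm t < (1 - k * norm x) * (1 - k * norm y)"

lemma conv_region_sums:
  assumes k: "k > 0" and r: "conv_region k x y t"
  shows "k * norm t + k * norm x < 1" "k * norm t + k * norm y < 1"
proof -
  have x: "0 \<le> k * norm x" "k * norm x < 1" and y: "0 \<le> k * norm y" "k * norm y < 1"
    and t: "k * norm t < (1 - k * norm x) * (1 - k * norm y)"
    using k r by (simp_all add: conv_region_def)
  have "(1 - k * norm x) * (1 - k * norm y) \<le> 1 - k * norm x"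
    by (rule mult_left_le) (use x y in linarith)+
  with t show "k * norm t + k * norm x < 1" by linarith
  have "(1 - k * norm x) * (1 - k * norm y) \<le> 1 - k * norm y"
    by (rule mult_left_le_one_le) (use x y in linarith)+
  with t show "k * norm t + k * norm y < 1" by linarith
qed

lemma norm_base_ge:
  assumes "k > 0"
  shows "1 - k * norm t - k * norm x \<le> Re (1 - of_real k * t - of_real k * x)"
proof -
  have "k * Re t \<le> k * norm t" "k * Re x \<le> k * norm x"
    using assms by (auto intro!: mult_left_mono complex_Re_le_cmod)
  then show ?thesis by simp
qed

lemma conv_region_Re:
  assumes k: "k > 0" and r: "conv_region k x y t"
  shows "Re (1 - of_real k * t) > 0"
    and "Re (1 - of_real k * t - of_real k * x) > 0"
    and "Re (1 - of_real k * t - of_real k * y) > 0"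
proof -
  have "0 \<le> k * norm x" using k by simp
  then show "Re (1 - of_real k * t) > 0"
    using norm_base_ge[OF k, of t 0] conv_region_sums[OF k r] by simp
  show "Re (1 - of_real k * t - of_real k * x) > 0"
    "Re (1 - of_real k * t - of_real k * y) > 0"
    using norm_base_ge[OF k, of t x] norm_base_ge[OF k, of t y] conv_region_sums[OF k r]
    by linarith+
qed

lemma conv_region_inner:
  assumes k: "k > 0" and r: "conv_region k x y t"
  shows "k * norm (x / (1 - of_real k * t)) < 1" "k * norm (y / (1 - of_real k * t)) < 1"
proof -
  have "1 - k * norm t \<le> norm (1 - of_real k * t)"
    using norm_base_ge[OF k, of t 0] complex_Re_le_cmod[of "1 - of_real k * t"] by simp
  moreover have "1 - of_real k * t \<noteq> 0"
    using conv_region_Re(1)[OF k r] by (metis less_irrefl zero_complex.simps(1))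
  ultimately show "k * norm (x / (1 - of_real k * t)) < 1" "k * norm (y / (1 - of_real k * t)) < 1"
    using conv_region_sums[OF k r] by (simp_all add: norm_divide divide_less_eq)
qed

lemma conv_region_outer:
  assumes k: "k > 0" and r: "conv_region k x y t"
  shows "k * norm (of_real k ^ 2 * x * y * t /
           ((1 - of_real k * t - of_real k * x) * (1 - of_real k * t - of_real k * y))) < 1"
proof -
  define \<xi> \<eta> \<tau> where "\<xi> = k * norm x" and "\<eta> = k * norm y" and "\<tau> = k * norm t"
  define A where "A = norm (1 - of_real k * t - of_real k * x)"
  define B where "B = norm (1 - of_real k * t - of_real k * y)"
  have s: "\<tau> + \<xi> < 1" "\<tau> + \<eta> < 1" "0 \<le> \<xi>" "0 \<le> \<eta>" "\<tau> < (1 - \<xi>) * (1 - \<eta>)"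
    using conv_region_sums[OF k r] k r by (auto simp: \<xi>_def \<eta>_def \<tau>_def conv_region_def)
  have A: "1 - \<tau> - \<xi> \<le> A" and B: "1 - \<tau> - \<eta> \<le> B"
    unfolding A_def B_def \<xi>_def \<eta>_def \<tau>_def
    by (rule order_trans[OF norm_base_ge[OF k] complex_Re_le_cmod])+
  have "(1 - \<tau> - \<xi>) * (1 - \<tau> - \<eta>) - \<xi> * \<eta> * \<tau> = (1 - \<tau>) * ((1 - \<xi>) * (1 - \<eta>) - \<tau>)"
    by (simp add: algebra_simps)
  moreover have "\<dots> > 0" using s by (intro mult_pos_pos) auto
  moreover have "(1 - \<tau> - \<xi>) * (1 - \<tau> - \<eta>) \<le> A * B"
    using s A B by (intro mult_mono) auto
  ultimately have "\<xi> * \<eta> * \<tau> < A * B" by linarith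
  moreover have "0 < A * B" using s A B by (intro mult_pos_pos) auto
  moreover have "k * norm (of_real k ^ 2 * x * y * t /
           ((1 - of_real k * t - of_real k * x) * (1 - of_real k * t - of_real k * y)))
         = \<xi> * \<eta> * \<tau> / (A * B)"
    using k unfolding norm_divide norm_mult norm_power A_def[symmetric] B_def[symmetric]
    by (simp add: \<xi>_def \<eta>_def \<tau>_def power2_eq_square)
  ultimately show ?thesis by simp
qed

end

theory Submission
  imports Defs
begin

text \<open>
  Since \<open>kpoch k a n = k ^ n * pochhammer (a / k) n\<close>, rescaling \<open>x\<close>, \<open>y\<close>, \<open>t\<close> by \<open>k\<close> and all
  parameters by \<open>1 / k\<close> reduces everything to Gauss hypergeometric functions. Write \<open>l\<close> for the
  rescaled \<open>lam\<close> and \<open>T\<close>, \<open>X\<close>, \<open>Y\<close> for \<open>k * t\<close>, \<open>k * x\<close>, \<open>k * y\<close>.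

  The first relation depends on the parameters \<open>\<alpha>, \<beta>, \<gamma>, \<delta>\<close> only through the coefficient sequences
  \<open>a p = pochhammer (\<alpha> / k) p / pochhammer (\<beta> / k) p * X ^ p\<close> and likewise \<open>b q\<close>, and it is bilinear
  in \<open>a\<close> and \<open>b\<close>. It therefore suffices to compare the factors of \<open>a p * b q\<close>. To see why they
  agree, sum them against \<open>u ^ p * v ^ q\<close>: the binomial series gives \<open>((1 - u) * (1 - v) - T) powr - l\<close>
  on the left, and on the right it gives the same function, written by means of
  \<open>(1 - T) * ((1 - u) * (1 - v) - T) = (1 - T - u) * (1 - T - v) - u * v * T\<close>.
  The lemma \<open>rise_mult_rise\<close> proves this comparison of coefficients by induction, and
  \<open>kernel_sums\<close> turns it into an identity between convergent series.

  The rearrangement is justified by absolute convergence. The sequences \<open>a\<close> and \<open>b\<close> are bounded by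
  multiples of \<open>\<rho> ^ p\<close> and \<open>\<sigma> ^ q\<close> with \<open>\<rho>\<close>, \<open>\<sigma>\<close> slightly above \<open>norm X\<close>, \<open>norm Y\<close>. After passing
  to norms, the sums over \<open>p\<close> and \<open>q\<close> are binomial series, and the sum over \<open>n\<close> is a binomial
  series in \<open>norm T / ((1 - \<rho>) * (1 - \<sigma>)) < 1\<close>. The triple series of the right side has a nonnegative
  majorant whose inner sums the same kernel identity evaluates, so its convergence is inherited.
  The result is \<open>bilinear_generating_relation\<close>.

  In the second relation the inner functions on the right of the first one degenerate to
  binomial series, whose powers combine with the outer argument; for this the bases have to lie in
  the right half plane, where quotients are compatible with principal powers.
\<close>

section \<open>Coefficients of the binomial series\<close>

text \<open>
  \<open>rise a n\<close> is the coefficient of \<open>z ^ n\<close> in \<open>(1 - z) powr - a\<close>. Dividing the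
  rising factorial by the factorial leaves identities in which only products of such
  coefficients occur.
\<close>

definition rise :: "'a::field_char_0 \<Rightarrow> nat \<Rightarrow> 'a" where
  "rise a n = pochhammer a n / fact n"

text \<open>
  The coefficient of \<open>z ^ n\<close> in \<open>z ^ r * (1 - z) powr - a\<close>. The zero value for \<open>n < r\<close> lets sums
  over \<open>r\<close> run over a range that does not depend on \<open>n\<close>.
\<close>

definition rise_at :: "'a::field_char_0 \<Rightarrow> nat \<Rightarrow> nat \<Rightarrow> 'a" where
  "rise_at a n r = (if r \<le> n then rise a (n - r) else 0)"

lemma rise_0 [simp]: "rise a 0 = 1"
  by (simp add: rise_def)

lemma rise_Suc: "of_nat (Suc m) * rise a (Suc m) = (a + of_nat m) * rise a m"
  by (simp add: rise_def pochhammer_Suc field_simps del: of_nat_Suc)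

lemma rise_Suc_shift: "of_nat (Suc m) * rise a (Suc m) = a * rise (a + 1) m"
  by (simp add: rise_def pochhammer_rec field_simps del: of_nat_Suc)

text \<open>
  Both sides are the rising factorial of \<open>a\<close> of length \<open>n + p\<close>, split at \<open>n\<close> or at \<open>p\<close>.
\<close>

lemma rise_swap: "rise a n * rise (a + of_nat n) p = rise a p * rise (a + of_nat p) n"
proof -
  have "pochhammer a n * pochhammer (a + of_nat n) p = pochhammer a p * pochhammer (a + of_nat p) n"
    by (metis pochhammer_product' add.commute)
  then show ?thesis by (simp add: rise_def mult.commute)
qed

lemma rise_binomial:
  assumes "r \<le> p"
  shows "rise a p * of_nat (p choose r) = rise a r * rise (a + of_nat r) (p - r)"
  using pochhammer_product[OF assms, of a]
  by (simp add: rise_def binomial_fact[OF assms])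

section \<open>The kernel identity\<close>

text \<open>
  In generating functions in \<open>n\<close>, multiplication by \<open>l + q + n\<close> is the operator
  \<open>l + q + z d/dz\<close>. Applied to \<open>z ^ r * (1 - z) powr - (l + p + q)\<close> it gives
  \<open>(l + q + r + (p - r) * z) * z ^ r * (1 - z) powr - (l + p + q + 1)\<close>.
  This lemma and the next one are the two halves of the induction step of \<open>rise_mult_rise\<close>.
\<close>

lemma rise_at_factor_n:
  "(l + of_nat q + of_nat n) * rise_at (l + of_nat p + of_nat q) n r =
     (l + of_nat q + of_nat r) * rise_at (l + of_nat p + of_nat (Suc q)) n r
     + (of_nat p - of_nat r) * rise_at (l + of_nat p + of_nat (Suc q)) n (Suc r)"
proof (cases "n \<le> r")
  case True
  then show ?thesis by (auto simp: rise_at_def)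
next
  case False
  define m where "m = n - Suc r"
  have n: "n = Suc (r + m)" using False by (simp add: m_def)
  \<comment> \<open>All three coefficients are multiples of \<open>w\<close>, which avoids dividing by \<open>b\<close>, possibly zero.\<close>
  define b where "b = l + of_nat p + of_nat q"
  define w where "w = rise (b + 1) m"
  have A: "rise b (Suc m) = b * w / of_nat (Suc m)"
    using rise_Suc_shift[of m b] unfolding w_def
    by (metis nonzero_mult_div_cancel_left of_nat_neq_0)
  have B: "rise (b + 1) (Suc m) = (b + 1 + of_nat m) * w / of_nat (Suc m)"
    using rise_Suc[of m "b + 1"] unfolding w_def
    by (metis nonzero_mult_div_cancel_left of_nat_neq_0)
  have c: "(of_nat (Suc m) :: 'a) \<noteq> 0" by (rule of_nat_neq_0)
  have "(l + of_nat q + of_nat n) * (b * w / of_nat (Suc m)) =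
     (l + of_nat q + of_nat r) * ((b + 1 + of_nat m) * w / of_nat (Suc m))
     + (of_nat p - of_nat r) * w"
    using c unfolding n by (simp add: field_simps b_def)
  moreover have "l + of_nat p + of_nat (Suc q) = b + 1" by (simp add: b_def)
  moreover have "rise_at b n r = b * w / of_nat (Suc m)"
    "rise_at (b + 1) n r = (b + 1 + of_nat m) * w / of_nat (Suc m)"
    "rise_at (b + 1) n (Suc r) = w"
    using A B by (simp_all add: rise_at_def n w_def Suc_diff_le del: of_nat_Suc)
  ultimately show ?thesis
    by (simp only: b_def[symmetric])
qed

text \<open>
  In a sum over \<open>r\<close> weighted by \<open>p choose r\<close>, the second term moves to the index \<open>r - 1\<close>. There
  \<open>(p choose Suc r) * Suc r = (p choose r) * (p - r)\<close> turns its factor \<open>r\<close> into the factor \<open>p - r\<close> of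
  the preceding lemma.
\<close>

lemma rise_at_factor_q:
  "of_nat (Suc q) * rise_at (l + of_nat r) (Suc q) r =
     (l + of_nat q + of_nat r) * rise_at (l + of_nat r) q r
     + of_nat r * (if r = 0 then 0 else rise_at (l + of_nat (r - 1)) q (r - 1))"
proof (cases r)
  case 0
  then show ?thesis by (simp add: rise_at_def rise_Suc del: of_nat_Suc)
next
  case (Suc s)
  show ?thesis
  proof (cases "q \<le> s")
    case True
    then show ?thesis using Suc by (auto simp: rise_at_def)
  next
    case False
    define m where "m = q - Suc s"
    have q: "q = Suc (s + m)" using False by (simp add: m_def)
    define b where "b = l + of_nat s"
    define w where "w = rise (b + 1) m"
    have A: "rise b (Suc m) = b * w / of_nat (Suc m)"
      using rise_Suc_shift[of m b] unfolding w_def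
      by (metis nonzero_mult_div_cancel_left of_nat_neq_0)
    have B: "rise (b + 1) (Suc m) = (b + 1 + of_nat m) * w / of_nat (Suc m)"
      using rise_Suc[of m "b + 1"] unfolding w_def
      by (metis nonzero_mult_div_cancel_left of_nat_neq_0)
    have c: "(of_nat (Suc m) :: 'a) \<noteq> 0" by (rule of_nat_neq_0)
    have "of_nat (Suc q) * ((b + 1 + of_nat m) * w / of_nat (Suc m)) =
      (l + of_nat q + of_nat (Suc s)) * w + of_nat (Suc s) * (b * w / of_nat (Suc m))"
      using c unfolding q by (simp add: field_simps b_def)
    moreover have "l + of_nat (Suc s) = b + 1" by (simp add: b_def)
    moreover have "rise_at b q s = b * w / of_nat (Suc m)"
      "rise_at (b + 1) (Suc q) (Suc s) = (b + 1 + of_nat m) * w / of_nat (Suc m)"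
      "rise_at (b + 1) q (Suc s) = w"
      using A B by (simp_all add: rise_at_def q w_def Suc_diff_le del: of_nat_Suc)
    ultimately show ?thesis
      unfolding Suc by (simp add: b_def[symmetric] del: of_nat_Suc)
  qed
qed

text \<open>
  In essence this is Euler's transformation of the Gauss function with upper parameters
  \<open>l + p\<close>, \<open>l + q\<close> and lower parameter \<open>l\<close>, read off coefficientwise in its
  argument. Fix \<open>p\<close> and regard both sides as functions of \<open>q\<close>: up to the factor \<open>Suc q\<close>, each step from \<open>q\<close> to \<open>Suc q\<close> multiplies the left side
  by \<open>l + q + n\<close>, and the two factor lemmas show the same for the right side.
\<close>

lemma rise_mult_rise:
  "rise (l + of_nat p) n * rise (l + of_nat n) q =
     (\<Sum>r\<le>p. of_nat (p choose r) * rise_at (l + of_nat r) q r * rise_at (l + of_nat p + of_nat q) n r)"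
proof (induction q)
  case 0
  have "(\<Sum>r\<le>p. of_nat (p choose r) * rise_at (l + of_nat r) 0 r * rise_at (l + of_nat p + of_nat 0) n r)
     = (\<Sum>r\<in>{0}. of_nat (p choose r) * rise_at (l + of_nat r) 0 r * rise_at (l + of_nat p + of_nat 0) n r)"
    by (rule sum.mono_neutral_right) (auto simp: rise_at_def)
  then show ?case by (simp add: rise_at_def)
next
  case (Suc q)
  define w where "w r = rise_at (l + of_nat p + of_nat (Suc q)) n r" for r
  define e where "e r = rise_at (l + of_nat r) q r" for r
  define c where "c r = (of_nat (p choose r) :: 'a)" for r
  have c: "c (Suc r) * of_nat (Suc r) = c r * (of_nat p - of_nat r)" for r
  proof (cases "r \<le> p")
    case False
    then show ?thesis by (simp add: c_def binomial_eq_0)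
  next
    case True
    have "(p choose Suc r) * Suc r = (p choose r) * (p - r)"
      using binomial_absorb_comp[of p r] binomial_absorption[of r p] by (simp add: mult.commute)
    then have "c (Suc r) * of_nat (Suc r) = c r * of_nat (p - r)"
      unfolding c_def by (metis of_nat_mult)
    then show ?thesis using True by (simp add: of_nat_diff)
  qed
  have "of_nat (Suc q) * (\<Sum>r\<le>p. c r * rise_at (l + of_nat r) (Suc q) r * w r)
      = (\<Sum>r\<le>p. c r * (l + of_nat q + of_nat r) * e r * w r)
        + (\<Sum>r\<le>p. c r * of_nat r * (if r = 0 then 0 else e (r - 1)) * w r)"
    unfolding sum_distrib_left sum.distrib[symmetric]
  proof (rule sum.cong)
    fix r
    show "of_nat (Suc q) * (c r * rise_at (l + of_nat r) (Suc q) r * w r) =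
      c r * (l + of_nat q + of_nat r) * e r * w r + c r * of_nat r * (if r = 0 then 0 else e (r - 1)) * w r"
    proof -
      have "of_nat (Suc q) * (c r * rise_at (l + of_nat r) (Suc q) r * w r)
          = c r * w r * (of_nat (Suc q) * rise_at (l + of_nat r) (Suc q) r)"
        by (simp only: mult_ac)
      then show ?thesis
        unfolding rise_at_factor_q e_def by (simp only: distrib_left distrib_right mult_ac add_ac)
    qed
  qed simp
  also have "(\<Sum>r\<le>p. c r * of_nat r * (if r = 0 then 0 else e (r - 1)) * w r)
     = (\<Sum>r\<le>Suc p. c r * of_nat r * (if r = 0 then 0 else e (r - 1)) * w r)"
    by (simp add: c_def)
  also have "\<dots> = (\<Sum>r\<le>p. c (Suc r) * of_nat (Suc r) * e r * w (Suc r))"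
    by (subst sum.atMost_Suc_shift) simp
  also have "(\<Sum>r\<le>p. c r * (l + of_nat q + of_nat r) * e r * w r) + \<dots> =
     (\<Sum>r\<le>p. (l + of_nat q + of_nat n) * (c r * e r * rise_at (l + of_nat p + of_nat q) n r))"
    unfolding sum.distrib[symmetric]
  proof (rule sum.cong)
    fix r
    have "c r * (l + of_nat q + of_nat r) * e r * w r + c (Suc r) * of_nat (Suc r) * e r * w (Suc r)
       = c r * e r * ((l + of_nat q + of_nat r) * w r + (of_nat p - of_nat r) * w (Suc r))"
      unfolding c by (simp add: algebra_simps)
    also have "\<dots> = c r * e r * ((l + of_nat q + of_nat n) * rise_at (l + of_nat p + of_nat q) n r)"
      unfolding w_def rise_at_factor_n ..
    finally show "c r * (l + of_nat q + of_nat r) * e r * w r + c (Suc r) * of_nat (Suc r) * e r * w (Suc r)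
       = (l + of_nat q + of_nat n) * (c r * e r * rise_at (l + of_nat p + of_nat q) n r)"
      by (simp only: mult_ac)
  qed simp
  also have "\<dots> = (l + of_nat q + of_nat n) * (rise (l + of_nat p) n * rise (l + of_nat n) q)"
    unfolding Suc.IH c_def e_def sum_distrib_left ..
  also have "\<dots> = rise (l + of_nat p) n * ((l + of_nat n + of_nat q) * rise (l + of_nat n) q)"
    by (simp only: mult_ac add_ac)
  also have "\<dots> = of_nat (Suc q) * (rise (l + of_nat p) n * rise (l + of_nat n) (Suc q))"
    unfolding rise_Suc[symmetric] by (simp only: mult_ac)
  finally show ?case
    unfolding c_def w_def by (simp del: of_nat_Suc)
qed

lemma sums_rise_at:
  fixes a T :: "'a::real_normed_field"
  assumes "(\<lambda>m. rise a m * T ^ m) sums S"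
  shows "(\<lambda>n. rise_at a n r * T ^ n) sums (T ^ r * S)"
proof -
  have "(\<lambda>m. T ^ r * (rise a m * T ^ m)) sums (T ^ r * S)"
    using assms by (rule sums_mult)
  then have "(\<lambda>m. rise_at a (m + r) r * T ^ (m + r)) sums (T ^ r * S)"
    by (simp add: rise_at_def power_add mult_ac)
  then show ?thesis
    by (subst (asm) sums_zero_iff_shift) (auto simp: rise_at_def)
qed

text \<open>
  For \<open>S = (1 - T) powr - (l + p + q)\<close> both sides are the coefficient of \<open>u ^ p * v ^ q\<close> in
  \<open>((1 - u) * (1 - v) - T) powr - l\<close>. The value \<open>S\<close> of the binomial series is
  kept as a parameter, so that the identity serves complex series and their real majorants alike.
\<close>

lemma kernel_sums:
  fixes l T :: "'a::real_normed_field"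
  assumes "(\<lambda>m. rise (l + of_nat p + of_nat q) m * T ^ m) sums S"
  shows "(\<lambda>n. rise l n * T ^ n * (rise (l + of_nat n) p * rise (l + of_nat n) q)) sums
    (\<Sum>r\<le>p. rise l r * T ^ r * (rise_at (l + of_nat r) p r * rise_at (l + of_nat r) q r) * S)"
proof -
  define d where "d r = rise l p * of_nat (p choose r) * rise_at (l + of_nat r) q r" for r
  have d: "rise l r * T ^ r * (rise_at (l + of_nat r) p r * rise_at (l + of_nat r) q r) * S = d r * (T ^ r * S)"
    if "r \<le> p" for r
    using that by (simp add: d_def rise_binomial rise_at_def)
  have "rise l n * T ^ n * (rise (l + of_nat n) p * rise (l + of_nat n) q)
      = (\<Sum>r\<le>p. d r * (rise_at (l + of_nat p + of_nat q) n r * T ^ n))" for n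
  proof -
    have "rise l n * T ^ n * (rise (l + of_nat n) p * rise (l + of_nat n) q)
       = T ^ n * (rise l p * (rise (l + of_nat p) n * rise (l + of_nat n) q))"
      using rise_swap[of l n p] by (simp add: mult_ac)
    then show ?thesis
      unfolding rise_mult_rise d_def by (simp add: sum_distrib_left mult_ac)
  qed
  moreover have "(\<lambda>n. \<Sum>r\<le>p. d r * (rise_at (l + of_nat p + of_nat q) n r * T ^ n)) sums
     (\<Sum>r\<le>p. d r * (T ^ r * S))"
    by (intro sums_sum sums_mult sums_rise_at assms)
  moreover have "(\<Sum>r\<le>p. d r * (T ^ r * S)) =
      (\<Sum>r\<le>p. rise l r * T ^ r * (rise_at (l + of_nat r) p r * rise_at (l + of_nat r) q r) * S)"
    by (rule sum.cong) (simp_all only: d atMost_iff)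
  ultimately show ?thesis by simp
qed

section \<open>Majorants\<close>

lemma norm_rise_le:
  fixes a :: "'a::real_normed_field"
  shows "norm (rise a n) \<le> rise (norm a) n"
proof -
  have "norm (pochhammer a n) \<le> pochhammer (norm a) n"
  proof (induction n)
    case (Suc n)
    have "norm (a + of_nat n) \<le> norm a + of_nat n"
      by (rule order_trans[OF norm_triangle_ineq]) simp
    with Suc show ?case
      unfolding pochhammer_Suc norm_mult
      by (intro mult_mono) (auto simp: pochhammer_prod intro!: prod_nonneg)
  qed simp
  then show ?thesis by (simp add: rise_def norm_divide divide_right_mono)
qed

lemma rise_mono: "0 \<le> a \<Longrightarrow> a \<le> b \<Longrightarrow> rise a n \<le> rise b n" for a b :: real
  unfolding rise_def pochhammer_prod by (intro divide_right_mono prod_mono) auto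

lemma rise_nonneg: "0 \<le> a \<Longrightarrow> 0 \<le> rise a n" for a :: real
  unfolding rise_def pochhammer_prod by (intro divide_nonneg_nonneg prod_nonneg) auto

lemma rise_at_nonneg: "0 \<le> a \<Longrightarrow> 0 \<le> rise_at a n r" for a :: real
  by (simp add: rise_at_def rise_nonneg)

lemma rise_eq_gbinomial: "rise a n = (- 1) ^ n * (- a gchoose n)"
  by (simp add: rise_def gbinomial_pochhammer)

lemma rise_sums_complex:
  fixes a z :: complex
  assumes "norm z < 1"
  shows "(\<lambda>n. rise a n * z ^ n) sums (1 - z) powr (- a)"
  using gen_binomial_complex[of "- z" "- a"] assms
  by (simp add: rise_eq_gbinomial power_minus[of z] mult_ac)

lemma rise_sums_real:
  fixes a z :: real
  assumes "\<bar>z\<bar> < 1"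
  shows "(\<lambda>n. rise a n * z ^ n) sums (1 - z) powr (- a)"
  using gen_binomial_real[of "- z" "- a"] assms
  by (simp add: rise_eq_gbinomial power_minus[of z] mult_ac)

lemma rise_has_sum_real:
  fixes a z :: real
  assumes "0 \<le> a" "0 \<le> z" "z < 1"
  shows "((\<lambda>n. rise a n * z ^ n) has_sum (1 - z) powr (- a)) UNIV"
  using assms by (intro sums_nonneg_imp_has_sum rise_sums_real) (auto simp: rise_nonneg)

text \<open>
  The binomial series with exponent \<open>norm a\<close> is a majorant.
\<close>

lemma rise_abs_summable:
  fixes a :: complex and c :: "nat \<Rightarrow> complex"
  assumes x: "0 \<le> x" "x < 1" and c: "\<And>i. norm (c i) \<le> C * x ^ i"
  shows "(\<lambda>i. norm (rise a i * c i)) summable_on UNIV"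
proof (rule Infinite_Sum.abs_summable_on_comparison_test')
  show "(\<lambda>i. C * (rise (norm a) i * x ^ i)) summable_on UNIV"
    using x by (intro summable_on_cmult_right has_sum_imp_summable[OF rise_has_sum_real]) auto
  fix i
  have "norm (rise a i * c i) \<le> rise (norm a) i * (C * x ^ i)"
    unfolding norm_mult by (intro mult_mono norm_rise_le c rise_nonneg) auto
  then show "norm (rise a i * c i) \<le> C * (rise (norm a) i * x ^ i)"
    by (simp add: mult_ac)
qed

lemma has_sum_product:
  fixes f :: "'b \<Rightarrow> 'a::{real_normed_field, banach}" and g :: "'c \<Rightarrow> 'a"
  assumes f: "(\<lambda>x. norm (f x)) summable_on A" "(f has_sum s) A" and g: "(\<lambda>y. norm (g y)) summable_on B" "(g has_sum t) B"
  shows "((\<lambda>(x, y). f x * g y) has_sum s * t) (A \<times> B)"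
proof (rule has_sum_SigmaI)
  show "((\<lambda>y. case (x, y) of (x, y) \<Rightarrow> f x * g y) has_sum f x * t) B" for x
    using g(2) by (simp add: has_sum_cmult_right)
  show "((\<lambda>x. f x * t) has_sum s * t) A"
    using f(2) by (rule has_sum_cmult_left)
  have "(\<lambda>xy. norm ((\<lambda>(x, y). f x * g y) xy)) summable_on A \<times> B"
    unfolding Infinite_Sum.abs_summable_on_Sigma_iff
    using f(1) g(1)
    by (auto simp: norm_mult infsum_cmult_right' abs_mult infsum_nonneg
        intro!: summable_on_cmult_right summable_on_cmult_left)
  then show "(\<lambda>(x, y). f x * g y) summable_on A \<times> B"
    by (rule Infinite_Sum.abs_summable_summable)
qed

section \<open>Rearranging the triple series\<close>

text \<open>
  The terms of the triple series on the two sides of the generating relation, for arbitrary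
  coefficient sequences \<open>a\<close> and \<open>b\<close>. Both are indexed by the pair \<open>(p, q)\<close> of the coefficients
  \<open>a p\<close> and \<open>b q\<close> that they contain, since the two sides agree for each such pair separately.
\<close>

definition generating_term :: "'a::real_normed_field \<Rightarrow> 'a \<Rightarrow> (nat \<Rightarrow> 'a) \<Rightarrow> (nat \<Rightarrow> 'a) \<Rightarrow> nat \<Rightarrow> nat \<times> nat \<Rightarrow> 'a" where
  "generating_term l T a b n = (\<lambda>(p, q).
     rise l n * T ^ n * ((rise (l + of_nat n) p * a p) * (rise (l + of_nat n) q * b q)))"

definition transformed_term :: "'a::real_normed_field \<Rightarrow> 'a \<Rightarrow> (nat \<Rightarrow> 'a) \<Rightarrow> (nat \<Rightarrow> 'a) \<Rightarrow> nat \<Rightarrow> nat \<times> nat \<Rightarrow> 'a" where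
  "transformed_term l T a b r = (\<lambda>(p, q).
     rise l r * T ^ r * ((rise_at (l + of_nat r) p r * (a p / (1 - T) ^ p))
                       * (rise_at (l + of_nat r) q r * (b q / (1 - T) ^ q))))"

lemma generating_term_sums:
  fixes l T :: "'a::real_normed_field"
  assumes "(\<lambda>m. rise (l + of_nat p + of_nat q) m * T ^ m) sums (E / (1 - T) ^ (p + q))"
  shows "(\<lambda>n. generating_term l T a b n (p, q)) sums (E * (\<Sum>r\<le>p. transformed_term l T a b r (p, q)))"
proof -
  have "(\<lambda>n. a p * b q * (rise l n * T ^ n * (rise (l + of_nat n) p * rise (l + of_nat n) q))) sums
    (a p * b q * (\<Sum>r\<le>p. rise l r * T ^ r * (rise_at (l + of_nat r) p r * rise_at (l + of_nat r) q r) * (E / (1 - T) ^ (p + q))))"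
    by (intro sums_mult kernel_sums assms)
  then show ?thesis
    by (simp add: generating_term_def transformed_term_def sum_distrib_left power_add mult_ac)
qed

lemma transformed_term_has_sum:
  "((\<lambda>r. transformed_term l T a b r (p, q)) has_sum (\<Sum>r\<le>p. transformed_term l T a b r (p, q))) UNIV"
  by (rule has_sum_finite_neutralI[where B = "{..p}"]) (auto simp: transformed_term_def rise_at_def)

text \<open>
  For nonnegative data the sums over \<open>p\<close> and \<open>q\<close> are binomial series with the values
  \<open>(1 - x) powr - (L + n)\<close> and \<open>(1 - y) powr - (L + n)\<close>. What remains is a binomial series in
  \<open>t / ((1 - x) * (1 - y))\<close>, which is where the condition on \<open>t\<close> comes from.
\<close>

lemma generating_majorant_summable:
  fixes L x y t :: real
  assumes "0 \<le> L" and x: "0 \<le> x" "x < 1" and y: "0 \<le> y" "y < 1"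
    and t: "0 \<le> t" "t < (1 - x) * (1 - y)"
  shows "(\<lambda>(n, pq). generating_term L t ((^) x) ((^) y) n pq) summable_on UNIV \<times> UNIV"
proof (rule summable_on_SigmaI)
  define z where "z = t / ((1 - x) * (1 - y))"
  have z: "0 \<le> z" "z < 1" using assms by (auto simp: z_def divide_less_eq)
  let ?g = "\<lambda>n. (1 - x) powr (-L) * (1 - y) powr (-L) * (rise L n * z ^ n)"
  show "?g summable_on UNIV"
    using z \<open>0 \<le> L\<close> by (intro summable_on_cmult_right has_sum_imp_summable[OF rise_has_sum_real]) auto
  fix n :: nat
  have s: "((\<lambda>p. rise (L + of_nat n) p * u ^ p) has_sum (1 - u) powr (- L) / (1 - u) ^ n) UNIV"
    if "0 \<le> u" "u < 1" for u
  proof -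
    have "(1 - u) powr (- (L + of_nat n)) = (1 - u) powr (- L) / (1 - u) ^ n"
      using that by (simp add: powr_diff powr_realpow)
    then show ?thesis
      using rise_has_sum_real[of "L + of_nat n" u] that \<open>0 \<le> L\<close> by simp
  qed
  have ab: "(\<lambda>p. norm (rise (L + of_nat n) p * u ^ p)) summable_on UNIV" if "0 \<le> u" "u < 1" for u
    using has_sum_imp_summable[OF s[OF that]] by (subst (asm) summable_on_iff_abs_summable_on_real)
  have "((\<lambda>(p, q). (rise (L + of_nat n) p * x ^ p) * (rise (L + of_nat n) q * y ^ q)) has_sum
     ((1 - x) powr (- L) / (1 - x) ^ n) * ((1 - y) powr (- L) / (1 - y) ^ n)) (UNIV \<times> UNIV)"
    by (intro has_sum_product ab s x y)
  then have "((\<lambda>pq. rise L n * t ^ n * (case pq of (p, q) \<Rightarrow> (rise (L + of_nat n) p * x ^ p) * (rise (L + of_nat n) q * y ^ q))) has_sum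
     rise L n * t ^ n * (((1 - x) powr (- L) / (1 - x) ^ n) * ((1 - y) powr (- L) / (1 - y) ^ n))) (UNIV \<times> UNIV)"
    by (rule has_sum_cmult_right)
  then show "((\<lambda>pq. case (n, pq) of (n, pq) \<Rightarrow> generating_term L t ((^) x) ((^) y) n pq) has_sum ?g n) UNIV"
    by (simp add: generating_term_def case_prod_unfold z_def power_divide power_mult_distrib mult_ac)
  fix pq
  show "0 \<le> (case (n, pq) of (n, pq) \<Rightarrow> generating_term L t ((^) x) ((^) y) n pq)"
    using assms by (auto simp: generating_term_def case_prod_unfold intro!: mult_nonneg_nonneg rise_nonneg)
qed

text \<open>
  For fixed \<open>(p, q)\<close> the kernel identity gives the sum over \<open>r\<close> of
  these nonnegative terms as a constant multiple of the sum over \<open>n\<close> of the terms on the other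
  side, whose total is finite.
\<close>

lemma transformed_majorant_summable:
  fixes L x y t :: real
  assumes L: "0 \<le> L" and x: "0 \<le> x" "x < 1" and y: "0 \<le> y" "y < 1"
    and t: "0 \<le> t" "t < (1 - x) * (1 - y)"
  shows "(\<lambda>(pq, r). transformed_term L t ((^) x) ((^) y) r pq) summable_on UNIV \<times> UNIV"
proof (rule summable_on_SigmaI)
  have "(1 - x) * (1 - y) \<le> 1 * 1" using x y by (intro mult_mono) auto
  with t have t1: "t < 1" by simp
  have nonneg: "0 \<le> generating_term L t ((^) x) ((^) y) n pq" for n pq
    using assms by (auto simp: generating_term_def case_prod_unfold intro!: mult_nonneg_nonneg rise_nonneg)
  let ?f = "\<lambda>pq. infsum (\<lambda>n. generating_term L t ((^) x) ((^) y) n pq) UNIV"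
  have "(\<lambda>(pq, n). generating_term L t ((^) x) ((^) y) n pq) summable_on UNIV \<times> UNIV"
    using generating_majorant_summable[OF assms]
    by (subst summable_on_swap) (simp add: case_prod_unfold)
  then have sm: "(\<lambda>n. generating_term L t ((^) x) ((^) y) n pq) summable_on UNIV"
     and "?f summable_on UNIV" for pq
    using summable_on_SigmaD1[of "\<lambda>pq n. generating_term L t ((^) x) ((^) y) n pq" UNIV "\<lambda>_. UNIV" pq]
     summable_on_Sigma_banach[of "\<lambda>pq n. generating_term L t ((^) x) ((^) y) n pq" UNIV "\<lambda>_. UNIV"]
    by auto
  then show "(\<lambda>pq. (1 - t) powr L * ?f pq) summable_on UNIV"
    by (intro summable_on_cmult_right)
  fix pq :: "nat \<times> nat"
  obtain p q where pq: "pq = (p, q)" by fastforce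
  have "(1 - t) powr (- (L + of_nat p + of_nat q)) = (1 - t) powr (- L) / (1 - t) ^ (p + q)"
    using t1 by (simp add: powr_diff powr_realpow power_add)
  then have "(\<lambda>m. rise (L + of_nat p + of_nat q) m * t ^ m) sums ((1 - t) powr (- L) / (1 - t) ^ (p + q))"
    using rise_sums_real[of t "L + of_nat p + of_nat q"] t t1 by simp
  from generating_term_sums[OF this, of "(^) x" "(^) y"]
  have "(1 - t) powr (- L) * (\<Sum>r\<le>p. transformed_term L t ((^) x) ((^) y) r (p, q)) = ?f pq"
    using has_sum_imp_sums[OF has_sum_infsum[OF sm[of pq]]] unfolding pq by (rule sums_unique2)
  then have "(\<Sum>r\<le>p. transformed_term L t ((^) x) ((^) y) r (p, q)) = (1 - t) powr L * ?f pq"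
    using t1 by (simp add: powr_minus field_simps)
  then show "((\<lambda>r. case (pq, r) of (pq, r) \<Rightarrow> transformed_term L t ((^) x) ((^) y) r pq) has_sum (1 - t) powr L * ?f pq) UNIV"
    using transformed_term_has_sum[of L t "(^) x" "(^) y" p q] unfolding pq by simp
  fix r
  show "0 \<le> (case (pq, r) of (pq, r) \<Rightarrow> transformed_term L t ((^) x) ((^) y) r pq)"
    using assms t1
    by (auto simp: transformed_term_def case_prod_unfold
        intro!: divide_nonneg_nonneg mult_nonneg_nonneg rise_at_nonneg rise_nonneg)
qed

lemma norm_rise_add_le:
  fixes l :: complex
  shows "norm (rise (l + of_nat n) p) \<le> rise (norm l + of_nat n) p"
proof -
  have "norm (l + of_nat n) \<le> norm l + of_nat n"
    by (rule order_trans[OF norm_triangle_ineq]) simp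
  then show ?thesis
    by (rule order_trans[OF norm_rise_le rise_mono[OF norm_ge_zero]])
qed

lemma norm_rise_at_add_le:
  fixes l :: complex
  shows "norm (rise_at (l + of_nat n) p r) \<le> rise_at (norm l + of_nat n) p r"
  by (simp add: rise_at_def norm_rise_add_le)

lemma generating_term_abs_summable:
  fixes l T :: complex and a b :: "nat \<Rightarrow> complex" and x y :: real
  assumes x: "0 \<le> x" "x < 1" and y: "0 \<le> y" "y < 1"
    and a: "\<And>p. norm (a p) \<le> C * x ^ p" and b: "\<And>q. norm (b q) \<le> D * y ^ q"
    and T: "norm T < (1 - x) * (1 - y)"
  shows "(\<lambda>(n, pq). generating_term l T a b n pq) summable_on UNIV \<times> UNIV"
proof (rule Infinite_Sum.abs_summable_summable, rule Infinite_Sum.abs_summable_on_comparison_test')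
  have C0: "0 \<le> C" and D0: "0 \<le> D"
    using order_trans[OF norm_ge_zero a[of 0]] order_trans[OF norm_ge_zero b[of 0]] by simp_all
  show "(\<lambda>z. C * D * (case z of (n, pq) \<Rightarrow> generating_term (norm l) (norm T) ((^) x) ((^) y) n pq)) summable_on UNIV \<times> UNIV"
    using assms by (intro summable_on_cmult_right generating_majorant_summable) auto
  fix z :: "nat \<times> nat \<times> nat"
  obtain n p q where z: "z = (n, p, q)" by (cases z) auto
  have "norm (generating_term l T a b n (p, q)) \<le>
      rise (norm l) n * norm T ^ n * ((rise (norm l + of_nat n) p * (C * x ^ p)) * (rise (norm l + of_nat n) q * (D * y ^ q)))"
    unfolding generating_term_def prod.case norm_mult norm_power
    using C0 D0 x y
    by (intro mult_mono a b norm_rise_le norm_rise_add_le)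
       (auto intro!: mult_nonneg_nonneg rise_nonneg)
  then show "norm (case z of (n, pq) \<Rightarrow> generating_term l T a b n pq)
      \<le> C * D * (case z of (n, pq) \<Rightarrow> generating_term (norm l) (norm T) ((^) x) ((^) y) n pq)"
    by (simp add: z generating_term_def mult_ac)
qed

text \<open>
  Because \<open>1 - norm T \<le> norm (1 - T)\<close>, passing to norms leads to terms of the same form.
\<close>

lemma transformed_term_abs_summable:
  fixes l T :: complex and a b :: "nat \<Rightarrow> complex" and x y :: real
  assumes x: "0 \<le> x" "x < 1" and y: "0 \<le> y" "y < 1"
    and a: "\<And>p. norm (a p) \<le> C * x ^ p" and b: "\<And>q. norm (b q) \<le> D * y ^ q"
    and T: "norm T < (1 - x) * (1 - y)"
  shows "(\<lambda>(pq, r). transformed_term l T a b r pq) summable_on UNIV \<times> UNIV"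
proof (rule Infinite_Sum.abs_summable_summable, rule Infinite_Sum.abs_summable_on_comparison_test')
  have "(1 - x) * (1 - y) \<le> 1 * 1" using x y by (intro mult_mono) auto
  with T have T1: "0 < 1 - norm T" by simp
  have NT: "1 - norm T \<le> norm (1 - T)"
    using norm_triangle_ineq2[of 1 T] by simp
  have a': "norm (a p / (1 - T) ^ p) \<le> C * x ^ p / (1 - norm T) ^ p" for p
    unfolding norm_divide norm_power
    using order_trans[OF norm_ge_zero a] T1 NT
    by (intro frac_le a power_mono zero_less_power) auto
  have b': "norm (b p / (1 - T) ^ p) \<le> D * y ^ p / (1 - norm T) ^ p" for p
    unfolding norm_divide norm_power
    using order_trans[OF norm_ge_zero b] T1 NT
    by (intro frac_le b power_mono zero_less_power) auto
  have C0: "0 \<le> C" and D0: "0 \<le> D"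
    using order_trans[OF norm_ge_zero a[of 0]] order_trans[OF norm_ge_zero b[of 0]] by simp_all
  show "(\<lambda>z. C * D * (case z of (pq, r) \<Rightarrow> transformed_term (norm l) (norm T) ((^) x) ((^) y) r pq)) summable_on UNIV \<times> UNIV"
    using assms by (intro summable_on_cmult_right transformed_majorant_summable) auto
  fix z :: "(nat \<times> nat) \<times> nat"
  obtain p q r where z: "z = ((p, q), r)" by (cases z) auto
  have "norm (transformed_term l T a b r (p, q)) \<le>
      rise (norm l) r * norm T ^ r * ((rise_at (norm l + of_nat r) p r * (C * x ^ p / (1 - norm T) ^ p))
       * (rise_at (norm l + of_nat r) q r * (D * y ^ q / (1 - norm T) ^ q)))"
    unfolding transformed_term_def prod.case norm_mult norm_power
    using C0 D0 x y T1
    by (intro mult_mono a' b' norm_rise_le norm_rise_at_add_le)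
       (auto intro!: divide_nonneg_nonneg mult_nonneg_nonneg rise_at_nonneg rise_nonneg)
  then show "norm (case z of (pq, r) \<Rightarrow> transformed_term l T a b r pq)
      \<le> C * D * (case z of (pq, r) \<Rightarrow> transformed_term (norm l) (norm T) ((^) x) ((^) y) r pq)"
    by (simp add: z transformed_term_def mult_ac)
qed

text \<open>
  Substituting \<open>p = r + i\<close>; the terms with \<open>p < r\<close> vanish.
\<close>

lemma rise_at_has_sum:
  fixes l w :: complex
  assumes "0 \<le> u" "u < 1" and c: "\<And>i. norm (c (r + i) * w ^ i) \<le> C * u ^ i"
  shows "(\<lambda>p. norm (rise_at (l + of_nat r) p r * (c p * w ^ p))) summable_on UNIV"
    and "((\<lambda>p. rise_at (l + of_nat r) p r * (c p * w ^ p)) has_sum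
           w ^ r * (\<Sum>i. rise (l + of_nat r) i * (c (r + i) * w ^ i))) UNIV"
proof -
  let ?f = "\<lambda>p. rise_at (l + of_nat r) p r * (c p * w ^ p)"
  let ?g = "\<lambda>i. rise (l + of_nat r) i * (c (r + i) * w ^ i)"
  have ab: "(\<lambda>i. norm (?g i)) summable_on UNIV"
    by (rule rise_abs_summable[OF assms])
  have shift: "?f (r + i) = w ^ r * ?g i" for i
    by (simp add: rise_at_def power_add mult_ac)
  have range_eq: "range ((+) r) = {r..}"
    by (auto simp: image_iff le_iff_add)
  have "(\<lambda>p. norm (?f p)) summable_on UNIV \<longleftrightarrow> (\<lambda>p. norm (?f p)) summable_on range ((+) r)"
    unfolding range_eq by (rule summable_on_cong_neutral) (auto simp: rise_at_def)
  also have "\<dots> \<longleftrightarrow> (\<lambda>i. norm (w ^ r) * norm (?g i)) summable_on UNIV"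
    by (subst summable_on_reindex) (simp_all only: o_def shift norm_mult[of "w ^ r"] inj_on_add)
  finally show "(\<lambda>p. norm (?f p)) summable_on UNIV"
    using ab by (simp add: summable_on_cmult_right)
  have "summable (\<lambda>i. norm (?g i))"
    using ab by (rule summable_on_imp_summable)
  then have "(?g has_sum (\<Sum>i. ?g i)) UNIV"
    by (intro norm_summable_imp_has_sum summable_sums[OF summable_norm_cancel])
  then have "((\<lambda>i. w ^ r * ?g i) has_sum w ^ r * (\<Sum>i. ?g i)) UNIV"
    by (rule has_sum_cmult_right)
  then have "(?f has_sum w ^ r * (\<Sum>i. ?g i)) (range ((+) r))"
    by (subst has_sum_reindex) (simp_all only: o_def shift inj_on_add)
  then show "(?f has_sum w ^ r * (\<Sum>i. ?g i)) UNIV"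
    unfolding range_eq by (rule has_sum_cong_neutral[THEN iffD1, rotated -1]) (auto simp: rise_at_def)
qed

lemma powr_diff_of_nat:
  fixes z a :: complex
  assumes "z \<noteq> 0"
  shows "z powr (a - of_nat n) = z powr a / z ^ n"
proof -
  have "z powr of_nat n = z ^ n" using assms by (subst powr_nat') auto
  then show ?thesis by (simp add: powr_diff)
qed

text \<open>
  The generating relation for arbitrary coefficient sequences of geometric growth. Let \<open>S\<close> and
  \<open>S'\<close> be the sums of the two absolutely convergent triple series. Summing the first over
  \<open>(p, q)\<close> and then over \<open>n\<close> gives the left side, and summing the second over \<open>(p, q)\<close> and then
  over \<open>r\<close> gives the series of the \<open>R r\<close>. Summing both over \<open>(p, q)\<close> last instead, the kernel
  identity shows \<open>S = (1 - T) powr (- l) * S'\<close>.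
\<close>

theorem bilinear_generating_relation:
  fixes l T :: complex and a b :: "nat \<Rightarrow> complex" and x y :: real
  assumes x: "0 \<le> x" "x < 1" and y: "0 \<le> y" "y < 1"
    and a: "\<And>p. norm (a p) \<le> C * x ^ p" and b: "\<And>q. norm (b q) \<le> D * y ^ q"
    and T: "norm T < (1 - x) * (1 - y)"
  defines "R \<equiv> \<lambda>r. rise l r * (T / (1 - T) ^ 2) ^ r
     * (\<Sum>i. rise (l + of_nat r) i * (a (r + i) / (1 - T) ^ i))
     * (\<Sum>j. rise (l + of_nat r) j * (b (r + j) / (1 - T) ^ j))"
  shows "summable R"
    and "(\<lambda>n. rise l n * T ^ n * (\<Sum>p. rise (l + of_nat n) p * a p) * (\<Sum>q. rise (l + of_nat n) q * b q))
      sums ((1 - T) powr (- l) * (\<Sum>r. R r))"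
proof -
  have "(1 - x) * (1 - y) \<le> 1 * 1" "(1 - x) * (1 - y) \<le> (1 - x) * 1" "(1 - x) * (1 - y) \<le> 1 * (1 - y)"
    using x y by (intro mult_mono; simp)+
  with T have T1: "0 < 1 - norm T" and xT: "x < 1 - norm T" and yT: "y < 1 - norm T" by simp_all
  have NT: "1 - norm T \<le> norm (1 - T)"
    using norm_triangle_ineq2[of 1 T] by simp
  have T0: "1 - T \<noteq> 0" using T1 NT by auto
  define v where "v = 1 / (1 - T)"
  have inv: "z / (1 - T) ^ i = z * v ^ i" for z i
    by (simp add: v_def divide_inverse power_inverse)

  define S where "S = infsum (\<lambda>(n, pq). generating_term l T a b n pq) (UNIV \<times> UNIV)"
  have S: "((\<lambda>(n, pq). generating_term l T a b n pq) has_sum S) (UNIV \<times> UNIV)"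
    unfolding S_def by (intro has_sum_infsum generating_term_abs_summable[OF x y a b T])
  define S' where "S' = infsum (\<lambda>(pq, r). transformed_term l T a b r pq) (UNIV \<times> UNIV)"
  have S': "((\<lambda>(pq, r). transformed_term l T a b r pq) has_sum S') (UNIV \<times> UNIV)"
    unfolding S'_def by (intro has_sum_infsum transformed_term_abs_summable[OF x y a b T])

  \<comment> \<open>The one-variable sums over \<open>p\<close> and over \<open>q\<close> have the same shape, so they are treated
    together, with \<open>c\<close> standing for \<open>a\<close> or \<open>b\<close>.\<close>
  have shifted_sums: "(\<lambda>p. norm (rise_at (l + of_nat r) p r * (c p * w ^ p))) summable_on UNIV"
      "((\<lambda>p. rise_at (l + of_nat r) p r * (c p * w ^ p)) has_sum
           w ^ r * (\<Sum>i. rise (l + of_nat r) i * (c (r + i) * w ^ i))) UNIV"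
    if u: "0 \<le> u" "u * norm w < 1" and c: "\<And>i. norm (c i) \<le> K * u ^ i" for c K u w r
  proof -
    have *: "norm (c (r + i) * w ^ i) \<le> (K * u ^ r) * (u * norm w) ^ i" for i
    proof -
      have "norm (c (r + i) * w ^ i) \<le> (K * u ^ (r + i)) * norm w ^ i"
        unfolding norm_mult norm_power by (intro mult_right_mono c) auto
      then show ?thesis by (simp add: power_add power_mult_distrib mult_ac)
    qed
    show "(\<lambda>p. norm (rise_at (l + of_nat r) p r * (c p * w ^ p))) summable_on UNIV"
      "((\<lambda>p. rise_at (l + of_nat r) p r * (c p * w ^ p)) has_sum
           w ^ r * (\<Sum>i. rise (l + of_nat r) i * (c (r + i) * w ^ i))) UNIV"
      using u by (auto intro!: rise_at_has_sum[where u = "u * norm w", OF _ _ *])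
  qed
  have xv: "x * norm v < 1" and yv: "y * norm v < 1"
    using xT yT T1 NT by (auto simp: v_def norm_divide divide_less_eq)

  have transformed_sum: "((\<lambda>pq. transformed_term l T a b r pq) has_sum R r) UNIV" for r
  proof -
    have "((\<lambda>(p, q). (rise_at (l + of_nat r) p r * (a p * v ^ p)) * (rise_at (l + of_nat r) q r * (b q * v ^ q)))
       has_sum (v ^ r * (\<Sum>i. rise (l + of_nat r) i * (a (r + i) * v ^ i)))
              * (v ^ r * (\<Sum>i. rise (l + of_nat r) i * (b (r + i) * v ^ i)))) (UNIV \<times> UNIV)"
      by (intro has_sum_product shifted_sums[OF x(1) xv a] shifted_sums[OF y(1) yv b])
    from has_sum_cmult_right[OF this, of "rise l r * T ^ r"]
    have "((\<lambda>pq. transformed_term l T a b r pq) has_sum rise l r * T ^ r *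
         ((v ^ r * (\<Sum>i. rise (l + of_nat r) i * (a (r + i) * v ^ i)))
              * (v ^ r * (\<Sum>i. rise (l + of_nat r) i * (b (r + i) * v ^ i))))) UNIV"
      by (simp only: transformed_term_def inv case_prod_unfold UNIV_Times_UNIV)
    moreover have "(T * v ^ 2) ^ r = T ^ r * v ^ r * v ^ r"
      by (simp add: power_mult_distrib power2_eq_square)
    ultimately show ?thesis
      unfolding R_def inv by (simp only: mult_ac)
  qed
  have "((\<lambda>(r, pq). transformed_term l T a b r pq) has_sum S') (UNIV \<times> UNIV)"
    using S' by (subst (asm) has_sum_swap) simp
  then have R: "(R has_sum S') UNIV"
    by (rule has_sum_SigmaD) (simp add: transformed_sum)
  then show "summable R" using has_sum_imp_sums sums_summable by blast
  have suminf_R: "(\<Sum>r. R r) = S'" using sums_unique[OF has_sum_imp_sums[OF R]] by simp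

  have generating_sum: "((\<lambda>pq. generating_term l T a b n pq) has_sum
     rise l n * T ^ n * (\<Sum>p. rise (l + of_nat n) p * a p) * (\<Sum>q. rise (l + of_nat n) q * b q)) UNIV" for n
  proof -
    have s: "(\<lambda>p. norm (rise (l + of_nat n) p * c p)) summable_on UNIV"
      "((\<lambda>p. rise (l + of_nat n) p * c p) has_sum (\<Sum>p. rise (l + of_nat n) p * c p)) UNIV"
      if "0 \<le> u" "u < 1" "\<And>i. norm (c i) \<le> K * u ^ i" for c K u
    proof -
      show *: "(\<lambda>p. norm (rise (l + of_nat n) p * c p)) summable_on UNIV"
        by (rule rise_abs_summable[OF that])
      then have "summable (\<lambda>p. norm (rise (l + of_nat n) p * c p))"
        by (rule summable_on_imp_summable)
      then show "((\<lambda>p. rise (l + of_nat n) p * c p) has_sum (\<Sum>p. rise (l + of_nat n) p * c p)) UNIV"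
        by (intro norm_summable_imp_has_sum summable_sums[OF summable_norm_cancel])
    qed
    have "((\<lambda>(p, q). (rise (l + of_nat n) p * a p) * (rise (l + of_nat n) q * b q))
       has_sum (\<Sum>p. rise (l + of_nat n) p * a p) * (\<Sum>q. rise (l + of_nat n) q * b q)) (UNIV \<times> UNIV)"
      by (intro has_sum_product s[OF x a] s[OF y b])
    from has_sum_cmult_right[OF this, of "rise l n * T ^ n"]
    show ?thesis
      by (simp add: generating_term_def case_prod_unfold mult.assoc)
  qed
  have L: "((\<lambda>n. rise l n * T ^ n * (\<Sum>p. rise (l + of_nat n) p * a p) * (\<Sum>q. rise (l + of_nat n) q * b q)) has_sum S) UNIV"
    by (rule has_sum_SigmaD[OF S]) (simp add: generating_sum)

  have swapS: "((\<lambda>(pq, n). generating_term l T a b n pq) has_sum S) (UNIV \<times> UNIV)"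
    using S by (subst (asm) has_sum_swap) simp
  have "((\<lambda>pq. (1 - T) powr (- l) * (\<Sum>r\<le>fst pq. transformed_term l T a b r pq)) has_sum S) UNIV"
  proof (rule has_sum_SigmaD[OF swapS])
    fix pq :: "nat \<times> nat"
    obtain p q where pq: "pq = (p, q)" by fastforce
    have "(1 - T) powr (- (l + of_nat p + of_nat q)) = (1 - T) powr (- l) / (1 - T) ^ (p + q)"
      using powr_diff_of_nat[OF T0, of "- l" "p + q"] by (simp add: algebra_simps)
    then have "(\<lambda>m. rise (l + of_nat p + of_nat q) m * T ^ m) sums ((1 - T) powr (- l) / (1 - T) ^ (p + q))"
      using rise_sums_complex[of T "l + of_nat p + of_nat q"] T1 by simp
    then have sums: "(\<lambda>n. generating_term l T a b n (p, q)) sums ((1 - T) powr (- l) * (\<Sum>r\<le>p. transformed_term l T a b r (p, q)))"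
      by (rule generating_term_sums)
    have "(\<lambda>n. generating_term l T a b n pq) summable_on UNIV"
      using summable_on_SigmaD1[of "\<lambda>pq n. generating_term l T a b n pq" UNIV "\<lambda>_. UNIV" pq]
        has_sum_imp_summable[OF swapS] by simp
    then have "((\<lambda>n. generating_term l T a b n pq) has_sum (infsum (\<lambda>n. generating_term l T a b n pq) UNIV)) UNIV"
      by (rule has_sum_infsum)
    moreover from has_sum_imp_sums[OF this] sums
    have "infsum (\<lambda>n. generating_term l T a b n pq) UNIV = (1 - T) powr (- l) * (\<Sum>r\<le>p. transformed_term l T a b r (p, q))"
      unfolding pq by (rule sums_unique2)
    ultimately show "((\<lambda>n. case (pq, n) of (pq, n) \<Rightarrow> generating_term l T a b n pq) has_sum
      (1 - T) powr (- l) * (\<Sum>r\<le>fst pq. transformed_term l T a b r pq)) UNIV"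
      by (simp add: pq)
  qed
  moreover have "((\<lambda>pq. \<Sum>r\<le>fst pq. transformed_term l T a b r pq) has_sum S') UNIV"
    by (rule has_sum_SigmaD[OF S']) (use transformed_term_has_sum in \<open>auto simp: split_paired_all\<close>)
  then have "((\<lambda>pq. (1 - T) powr (- l) * (\<Sum>r\<le>fst pq. transformed_term l T a b r pq)) has_sum (1 - T) powr (- l) * S') UNIV"
    by (rule has_sum_cmult_right)
  ultimately have "S = (1 - T) powr (- l) * S'" by (rule has_sum_unique)
  with L suminf_R show "(\<lambda>n. rise l n * T ^ n * (\<Sum>p. rise (l + of_nat n) p * a p) * (\<Sum>q. rise (l + of_nat n) q * b q))
      sums ((1 - T) powr (- l) * (\<Sum>r. R r))"
    by (simp add: has_sum_imp_sums)
qed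

section \<open>Specialisation to k-hypergeometric functions\<close>

text \<open>
  The coefficient sequence that turns \<open>bilinear_generating_relation\<close> into a statement about
  hypergeometric functions: \<open>\<Sum>p. rise c p * poch_quot a b x p\<close> is the Gauss function with
  upper parameters \<open>c\<close>, \<open>a\<close>, lower parameter \<open>b\<close> and argument \<open>x\<close>.
\<close>

definition poch_quot :: "complex \<Rightarrow> complex \<Rightarrow> complex \<Rightarrow> nat \<Rightarrow> complex" where
  "poch_quot a b x p = pochhammer a p / pochhammer b p * x ^ p"

text \<open>
  Dividing by \<open>\<rho> ^ p\<close> gives the terms of a convergent hypergeometric series with upper parameters
  \<open>a\<close>, \<open>1\<close> and argument \<open>x / \<rho>\<close>, and these are bounded.
\<close>

lemma poch_quot_bound:
  assumes "norm x < \<rho>"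
  obtains C where "\<And>p. norm (poch_quot a b x p) \<le> C * \<rho> ^ p"
proof -
  have \<rho>: "0 < \<rho>" using assms norm_ge_zero[of x] by linarith
  have one: "kpoch 1 c n = pochhammer c n" for c n
    using kpoch_eq_pochhammer[of 1 c n] by simp
  have "pochhammer (1 :: complex) n = fact n" for n by (simp add: pochhammer_fact)
  then have eq: "khyp_term 1 a 1 b (x / of_real \<rho>) p = poch_quot a b x p / of_real \<rho> ^ p" for p
    by (simp add: khyp_term_def one poch_quot_def power_divide)
  have "summable (khyp_term 1 a 1 b (x / of_real \<rho>))"
    using assms \<rho> by (intro khyp_summable) (auto simp: norm_divide divide_less_eq)
  then have "Bseq (khyp_term 1 a 1 b (x / of_real \<rho>))"
    using summable_LIMSEQ_zero convergentI convergent_imp_Bseq by blast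
  then obtain C where C: "\<And>p. norm (khyp_term 1 a 1 b (x / of_real \<rho>) p) \<le> C"
    by (auto simp: Bseq_def)
  show ?thesis
  proof
    fix p
    show "norm (poch_quot a b x p) \<le> C * \<rho> ^ p"
      using C[of p] \<rho> by (simp add: eq norm_divide norm_power divide_le_eq)
  qed
qed

lemma poch_quot_add:
  "poch_quot a b x (n + i) = poch_quot a b x n * poch_quot (a + of_nat n) (b + of_nat n) x i"
  by (simp add: poch_quot_def pochhammer_product' power_add)

lemma kpoch_eq_rise:
  assumes "k > 0"
  shows "kpoch k a n = of_real k ^ n * (fact n * rise (a / of_real k) n)"
  using assms by (simp add: kpoch_eq_pochhammer rise_def)

lemma khyp_term_eq_rise:
  assumes "k > 0"
  shows "khyp_term k a b c z p = rise (a / of_real k) p * poch_quot (b / of_real k) (c / of_real k) (of_real k * z) p"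
  using assms
  by (simp add: khyp_term_def poch_quot_def kpoch_eq_pochhammer rise_def power_mult_distrib field_simps)

lemma khyp_eq_rise:
  assumes "k > 0"
  shows "khyp k (a + of_nat n * of_real k) b c z =
    (\<Sum>p. rise (a / of_real k + of_nat n) p * poch_quot (b / of_real k) (c / of_real k) (of_real k * z) p)"
  using assms by (simp add: khyp_def khyp_term_eq_rise add_divide_distrib)

text \<open>
  The inner sums of the transformed series start at index \<open>n\<close> of the coefficient sequence. Taking
  out the coefficient of index \<open>n\<close> raises both of its parameters by \<open>n * k\<close>.
\<close>

lemma khyp_eq_rise_shift:
  assumes k: "k > 0" and z: "k * norm (z / w) < 1"
  shows "(\<Sum>i. rise (a / of_real k + of_nat n) i *
            (poch_quot (b / of_real k) (c / of_real k) (of_real k * z) (n + i) / w ^ i))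
    = poch_quot (b / of_real k) (c / of_real k) (of_real k * z) n
      * khyp k (a + of_nat n * of_real k) (b + of_nat n * of_real k) (c + of_nat n * of_real k) (z / w)"
proof -
  define h where "h = khyp_term k (a + of_nat n * of_real k) (b + of_nat n * of_real k) (c + of_nat n * of_real k) (z / w)"
  have "rise (a / of_real k + of_nat n) i *
            (poch_quot (b / of_real k) (c / of_real k) (of_real k * z) (n + i) / w ^ i)
      = poch_quot (b / of_real k) (c / of_real k) (of_real k * z) n * h i" for i
  proof -
    have "h i = rise (a / of_real k + of_nat n) i * poch_quot (b / of_real k + of_nat n) (c / of_real k + of_nat n) (of_real k * (z / w)) i"
      unfolding h_def khyp_term_eq_rise[OF k] using k by (simp add: add_divide_distrib)
    moreover have "poch_quot a' b' (of_real k * z) i / w ^ i = poch_quot a' b' (of_real k * (z / w)) i" for a' b'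
      by (simp add: poch_quot_def power_divide)
    ultimately show ?thesis
      unfolding poch_quot_add by (metis mult.left_commute times_divide_eq_right)
  qed
  moreover have "summable h" unfolding h_def by (rule khyp_summable[OF k z])
  ultimately show ?thesis by (simp add: suminf_mult khyp_def h_def)
qed

text \<open>
  Coefficient quotients grow slower than any geometric sequence of ratio above one but need not be
  bounded, so the radii have to be enlarged a little without leaving the region.
\<close>

lemma conv_region_margin:
  fixes x y t :: real
  assumes "0 \<le> x" "x < 1" "0 \<le> y" "y < 1" "0 \<le> t" "t < (1 - x) * (1 - y)"
  obtains \<rho> \<sigma> where "x < \<rho>" "\<rho> < 1" "y < \<sigma>" "\<sigma> < 1" "t < (1 - \<rho>) * (1 - \<sigma>)"
proof -
  have "x < 1 - t / (1 - y)" using assms by (simp add: field_simps)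
  then obtain \<rho> where \<rho>: "x < \<rho>" "\<rho> < 1 - t / (1 - y)" using dense by blast
  have "0 \<le> t / (1 - y)" using assms by simp
  then have \<rho>1: "\<rho> < 1" using \<rho> by linarith
  have "t < (1 - \<rho>) * (1 - y)" using \<rho>(2) assms by (simp add: field_simps)
  then have "y < 1 - t / (1 - \<rho>)" using \<rho>1 by (simp add: field_simps)
  then obtain \<sigma> where \<sigma>: "y < \<sigma>" "\<sigma> < 1 - t / (1 - \<rho>)" using dense by blast
  have "0 \<le> t / (1 - \<rho>)" using assms \<rho>1 by simp
  then have \<sigma>1: "\<sigma> < 1" using \<sigma> by linarith
  have "t < (1 - \<rho>) * (1 - \<sigma>)" using \<sigma>(2) \<rho>1 by (simp add: field_simps)
  with \<rho> \<rho>1 \<sigma> \<sigma>1 that show ?thesis by blast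
qed

lemma kpoch_nonzero:
  assumes "\<forall>m::nat. b \<noteq> - (of_nat m * of_real k)"
  shows "kpoch k b n \<noteq> 0"
  using assms by (auto simp: kpoch_def add_eq_0_iff2)

text \<open>
  The two arguments lie strictly between \<open>- pi / 2\<close> and \<open>pi / 2\<close>, so their difference is a
  principal argument.
\<close>

lemma powr_divide_Re_pos:
  fixes u w a :: complex
  assumes u: "Re u > 0" and w: "Re w > 0"
  shows "(u / w) powr a = u powr a / w powr a"
proof -
  have nz: "u \<noteq> 0" "w \<noteq> 0" using u w by auto
  have "\<bar>Im (Ln u)\<bar> < pi / 2" "\<bar>Im (Ln w)\<bar> < pi / 2"
    using u w nz Re_Ln_pos_lt by blast+
  then have "Ln (u / w) = Ln u - Ln w"
    using nz by (intro Ln_unique) (auto simp: exp_diff)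
  then show ?thesis
    using nz by (simp add: powr_def right_diff_distrib exp_diff)
qed

lemma khyp_cancel:
  assumes k: "k > 0" and z: "k * norm z < 1" and c: "\<forall>m::nat. c \<noteq> - (of_nat m * of_real k)"
  shows "khyp k c a c z = (1 - of_real k * z) powr (- (a / of_real k))"
proof -
  have "khyp_term k c a c z = (\<lambda>p. rise (a / of_real k) p * (of_real k * z) ^ p)"
    using kpoch_nonzero[OF c] k
    by (auto simp: khyp_term_def fun_eq_iff kpoch_eq_rise power_mult_distrib)
  moreover have "norm (of_real k * z) < 1" using k z by (simp add: norm_mult)
  ultimately show ?thesis
    unfolding khyp_def using rise_sums_complex sums_unique by metis
qed

definition khyp_generating :: "real \<Rightarrow> complex \<Rightarrow> complex \<Rightarrow> complex \<Rightarrow> complex \<Rightarrow> complex \<Rightarrow> complex \<Rightarrow> complex \<Rightarrow> complex \<Rightarrow> nat \<Rightarrow> complex" where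
  "khyp_generating k lam \<alpha> \<beta> \<gamma> \<delta> x y t n = kpoch k lam n / fact n
            * khyp k (lam + of_nat n * of_real k) \<alpha> \<beta> x
            * khyp k (lam + of_nat n * of_real k) \<gamma> \<delta> y * t ^ n"

definition khyp_transformed :: "real \<Rightarrow> complex \<Rightarrow> complex \<Rightarrow> complex \<Rightarrow> complex \<Rightarrow> complex \<Rightarrow> complex \<Rightarrow> complex \<Rightarrow> complex \<Rightarrow> nat \<Rightarrow> complex" where
  "khyp_transformed k lam \<alpha> \<beta> \<gamma> \<delta> x y t n = kpoch k lam n * kpoch k \<alpha> n * kpoch k \<gamma> n / (kpoch k \<beta> n * kpoch k \<delta> n * fact n)
            * (of_real k ^ 2 * x * y * t / (1 - of_real k * t) ^ 2) ^ n
            * khyp k (lam + of_nat n * of_real k) (\<alpha> + of_nat n * of_real k) (\<beta> + of_nat n * of_real k)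
                (x / (1 - of_real k * t))
            * khyp k (lam + of_nat n * of_real k) (\<gamma> + of_nat n * of_real k) (\<delta> + of_nat n * of_real k)
                (y / (1 - of_real k * t))"

text \<open>
  With \<open>K = of_real k\<close>, this is \<open>bilinear_generating_relation\<close> for \<open>T = K * t\<close> and the coefficient
  sequences with arguments \<open>K * x\<close> and \<open>K * y\<close>. Three k-symbols over two leave a factor \<open>K ^ n\<close>,
  which together with \<open>(K ^ 2) ^ n\<close> rescales each of \<open>x\<close>, \<open>y\<close> and \<open>t\<close> by \<open>K\<close>.
\<close>

lemma khyp_product_generating:
  fixes k :: real and lam \<alpha> \<beta> \<gamma> \<delta> x y t :: complex
  assumes k: "k > 0" and region: "conv_region k x y t"
  shows "summable (khyp_transformed k lam \<alpha> \<beta> \<gamma> \<delta> x y t)"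
    and "khyp_generating k lam \<alpha> \<beta> \<gamma> \<delta> x y t sums
      ((1 - of_real k * t) powr (- (lam / of_real k)) * (\<Sum>n. khyp_transformed k lam \<alpha> \<beta> \<gamma> \<delta> x y t n))"
proof -
  define K :: complex where "K = of_real k"
  have K0: "K \<noteq> 0" using k by (simp add: K_def)
  define A where "A = poch_quot (\<alpha> / K) (\<beta> / K) (K * x)"
  define B where "B = poch_quot (\<gamma> / K) (\<delta> / K) (K * y)"
  obtain \<rho> \<sigma> where \<rho>: "k * norm x < \<rho>" "\<rho> < 1" and \<sigma>: "k * norm y < \<sigma>" "\<sigma> < 1"
    and t: "k * norm t < (1 - \<rho>) * (1 - \<sigma>)"
    using region k unfolding conv_region_def
    by (elim conjE) (rule conv_region_margin[of "k * norm x" "k * norm y" "k * norm t"]; simp)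
  have norms: "norm (K * z) = k * norm z" for z using k by (simp add: K_def norm_mult)
  obtain C where C: "\<And>p. norm (A p) \<le> C * \<rho> ^ p"
    using poch_quot_bound[of "K * x" \<rho>] \<rho> unfolding A_def norms by metis
  obtain D where D: "\<And>p. norm (B p) \<le> D * \<sigma> ^ p"
    using poch_quot_bound[of "K * y" \<sigma>] \<sigma> unfolding B_def norms by metis
  have "0 \<le> k * norm x" "0 \<le> k * norm y" using k by simp_all
  with \<rho> \<sigma> have nn: "0 \<le> \<rho>" "0 \<le> \<sigma>" by linarith+
  have "norm (K * t) < (1 - \<rho>) * (1 - \<sigma>)" using t by (simp add: norms)
  note gen = bilinear_generating_relation[OF nn(1) \<rho>(2) nn(2) \<sigma>(2) C D this, of "lam / K"]

  have src: "khyp_generating k lam \<alpha> \<beta> \<gamma> \<delta> x y t = (\<lambda>n. rise (lam / K) n * (K * t) ^ n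
      * (\<Sum>p. rise (lam / K + of_nat n) p * A p) * (\<Sum>q. rise (lam / K + of_nat n) q * B q))"
    using k by (simp add: khyp_generating_def khyp_eq_rise kpoch_eq_rise A_def B_def K_def fun_eq_iff power_mult_distrib)
  have tgt: "khyp_transformed k lam \<alpha> \<beta> \<gamma> \<delta> x y t = (\<lambda>r. rise (lam / K) r * (K * t / (1 - K * t) ^ 2) ^ r
     * (\<Sum>i. rise (lam / K + of_nat r) i * (A (r + i) / (1 - K * t) ^ i))
     * (\<Sum>j. rise (lam / K + of_nat r) j * (B (r + j) / (1 - K * t) ^ j)))"
  proof
    fix r
    define F where "F = khyp k (lam + of_nat r * K) (\<alpha> + of_nat r * K) (\<beta> + of_nat r * K) (x / (1 - K * t))"
    define G where "G = khyp k (lam + of_nat r * K) (\<gamma> + of_nat r * K) (\<delta> + of_nat r * K) (y / (1 - K * t))"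
    have F: "(\<Sum>i. rise (lam / K + of_nat r) i * (A (r + i) / (1 - K * t) ^ i)) = A r * F"
      unfolding A_def F_def K_def using conv_region_inner(1)[OF k region] by (rule khyp_eq_rise_shift[OF k])
    have G: "(\<Sum>i. rise (lam / K + of_nat r) i * (B (r + i) / (1 - K * t) ^ i)) = B r * G"
      unfolding B_def G_def K_def using conv_region_inner(2)[OF k region] by (rule khyp_eq_rise_shift[OF k])
    have "kpoch k lam r * kpoch k \<alpha> r * kpoch k \<gamma> r / (kpoch k \<beta> r * kpoch k \<delta> r * fact r)
            * (K ^ 2 * x * y * t / (1 - K * t) ^ 2) ^ r
        = rise (lam / K) r * (K * t / (1 - K * t) ^ 2) ^ r * A r * B r" (is "?c = _")
    proof -
      define P where "P = (1 - K * t) ^ 2"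
      have "kpoch k c r = K ^ r * pochhammer (c / K) r" for c
        using k by (simp add: kpoch_eq_pochhammer K_def)
      then show ?thesis
        unfolding A_def B_def poch_quot_def rise_def P_def[symmetric] using K0
        by (simp add: power_mult_distrib power_divide power2_eq_square mult_ac)
    qed
    moreover have "khyp_transformed k lam \<alpha> \<beta> \<gamma> \<delta> x y t r = ?c * F * G"
      unfolding khyp_transformed_def F_def G_def K_def ..
    ultimately show "khyp_transformed k lam \<alpha> \<beta> \<gamma> \<delta> x y t r = rise (lam / K) r * (K * t / (1 - K * t) ^ 2) ^ r
     * (\<Sum>i. rise (lam / K + of_nat r) i * (A (r + i) / (1 - K * t) ^ i))
     * (\<Sum>j. rise (lam / K + of_nat r) j * (B (r + j) / (1 - K * t) ^ j))"
      unfolding F G by (simp only: mult_ac)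
  qed
  show "summable (khyp_transformed k lam \<alpha> \<beta> \<gamma> \<delta> x y t)"
    unfolding tgt by (rule gen(1))
  show "khyp_generating k lam \<alpha> \<beta> \<gamma> \<delta> x y t sums
      ((1 - of_real k * t) powr (- (lam / of_real k)) * (\<Sum>n. khyp_transformed k lam \<alpha> \<beta> \<gamma> \<delta> x y t n))"
    unfolding src tgt K_def[symmetric] by (rule gen(2))
qed

text \<open>
  When both lower parameters equal \<open>lam\<close>, every inner function has equal upper and lower parameters
  \<open>lam + n * k\<close> and is a power of \<open>u / w\<close> or \<open>v / w\<close>. The factors \<open>(w / u) ^ n\<close> and \<open>(w / v) ^ n\<close>
  contributed by the shifted exponents cancel the denominator \<open>w ^ 2\<close> of the outer argument, and
  the remaining series is a single k-hypergeometric function.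
\<close>

lemma suminf_khyp_transformed_cancel:
  fixes k :: real and lam \<alpha> \<gamma> x y t :: complex
  assumes k: "k > 0" and region: "conv_region k x y t"
    and lam: "\<forall>m::nat. lam \<noteq> - (of_nat m * of_real k)"
  defines "w \<equiv> 1 - of_real k * t"
    and "u \<equiv> 1 - of_real k * t - of_real k * x"
    and "v \<equiv> 1 - of_real k * t - of_real k * y"
  shows "(\<Sum>n. khyp_transformed k lam \<alpha> lam \<gamma> lam x y t n) =
    w powr ((\<gamma> + \<alpha>) / of_real k) * u powr (- (\<alpha> / of_real k)) * v powr (- (\<gamma> / of_real k))
          * khyp k \<alpha> \<gamma> lam (of_real k ^ 2 * x * y * t / (u * v))"
proof -
  have Re: "Re w > 0" "Re u > 0" "Re v > 0"
    unfolding w_def u_def v_def by (rule conv_region_Re[OF k region])+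
  then have nz: "w \<noteq> 0" "u \<noteq> 0" "v \<noteq> 0" by auto
  define c where "c = w powr ((\<gamma> + \<alpha>) / of_real k) * u powr (- (\<alpha> / of_real k)) * v powr (- (\<gamma> / of_real k))"
  have shift: "\<forall>m::nat. lam + of_nat n * of_real k \<noteq> - (of_nat m * of_real k)" for n
  proof
    fix m :: nat
    show "lam + of_nat n * of_real k \<noteq> - (of_nat m * of_real k)"
    proof
      assume "lam + of_nat n * of_real k = - (of_nat m * of_real k)"
      then have "lam = - (of_nat m * of_real k) - of_nat n * of_real k"
        by (simp only: eq_diff_eq)
      also have "\<dots> = - (of_nat (m + n) * of_real k)" by (simp add: distrib_right)
      finally show False using lam by blast
    qed
  qed
  have inner: "khyp k (lam + of_nat n * of_real k) (a + of_nat n * of_real k) (lam + of_nat n * of_real k) (z / w)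
      = s powr (- (a / of_real k)) * w powr (a / of_real k) * (w / s) ^ n"
    if z: "k * norm (z / w) < 1" and s: "Re s > 0" "s = w - of_real k * z" for n a z s
  proof -
    have s0: "s \<noteq> 0" using s(1) by auto
    have "1 - of_real k * (z / w) = s / w" using nz s(2) by (simp add: field_simps)
    moreover have "- ((a + of_nat n * of_real k) / of_real k) = - (a / of_real k) - of_nat n"
      using k by (simp add: add_divide_distrib)
    ultimately have "khyp k (lam + of_nat n * of_real k) (a + of_nat n * of_real k) (lam + of_nat n * of_real k) (z / w)
        = (s / w) powr (- (a / of_real k) - of_nat n)"
      using khyp_cancel[OF k z shift] by simp
    also have "\<dots> = (s / w) powr (- (a / of_real k)) / (s / w) ^ n"
      using s0 nz by (intro powr_diff_of_nat) auto
    also have "(s / w) powr (- (a / of_real k)) = s powr (- (a / of_real k)) * w powr (a / of_real k)"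
      using powr_divide_Re_pos[OF s(1) Re(1), of "- (a / of_real k)"]
      by (simp add: powr_minus divide_inverse)
    finally show ?thesis by (simp add: power_divide)
  qed
  have "khyp_transformed k lam \<alpha> lam \<gamma> lam x y t n = c * khyp_term k \<alpha> \<gamma> lam (of_real k ^ 2 * x * y * t / (u * v)) n" for n
  proof -
    have F: "khyp k (lam + of_nat n * of_real k) (\<alpha> + of_nat n * of_real k) (lam + of_nat n * of_real k) (x / w)
      = u powr (- (\<alpha> / of_real k)) * w powr (\<alpha> / of_real k) * (w / u) ^ n"
      using conv_region_inner(1)[OF k region] Re(2)
      by (intro inner) (simp_all add: w_def u_def)
    have G: "khyp k (lam + of_nat n * of_real k) (\<gamma> + of_nat n * of_real k) (lam + of_nat n * of_real k) (y / w)
      = v powr (- (\<gamma> / of_real k)) * w powr (\<gamma> / of_real k) * (w / v) ^ n"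
      using conv_region_inner(2)[OF k region] Re(3)
      by (intro inner) (simp_all add: w_def v_def)
    have wp: "w powr ((\<gamma> + \<alpha>) / of_real k) = w powr (\<gamma> / of_real k) * w powr (\<alpha> / of_real k)"
      using nz by (simp add: add_divide_distrib powr_add)
    have pw: "(of_real k ^ 2 * x * y * t / w ^ 2) ^ n * ((w / u) ^ n * (w / v) ^ n)
       = (of_real k ^ 2 * x * y * t / (u * v)) ^ n"
    proof -
      have "of_real k ^ 2 * x * y * t / w ^ 2 * ((w / u) * (w / v)) = of_real k ^ 2 * x * y * t / (u * v)"
        using nz by (simp add: power2_eq_square)
      then show ?thesis by (metis power_mult_distrib)
    qed
    have kq: "kpoch k lam n * kpoch k \<alpha> n * kpoch k \<gamma> n / (kpoch k lam n * kpoch k lam n * fact n)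
       = kpoch k \<alpha> n * kpoch k \<gamma> n / kpoch k lam n / fact n"
      using kpoch_nonzero[OF lam, of n] by simp
    show ?thesis
      unfolding khyp_transformed_def w_def[symmetric] F G khyp_term_def c_def kq wp pw[symmetric]
      by (simp only: mult_ac times_divide_eq_right times_divide_eq_left)
  qed
  moreover have "summable (khyp_term k \<alpha> \<gamma> lam (of_real k ^ 2 * x * y * t / (u * v)))"
    unfolding u_def v_def by (intro khyp_summable k conv_region_outer[OF k region])
  ultimately show ?thesis
    unfolding c_def[symmetric] khyp_def by (simp add: suminf_mult)
qed

theorem theorem21:
  fixes k :: real and lam \<alpha> \<beta> \<gamma> \<delta> x y t :: complex
  assumes k: "k > 0" and region: "conv_region k x y t"
  shows
    "((\<forall>m::nat. \<beta> \<noteq> - (of_nat m * of_real k)) \<and> (\<forall>m::nat. \<delta> \<noteq> - (of_nat m * of_real k)) \<longrightarrow>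
        summable (\<lambda>n. kpoch k lam n * kpoch k \<alpha> n * kpoch k \<gamma> n / (kpoch k \<beta> n * kpoch k \<delta> n * fact n)
            * (of_real k ^ 2 * x * y * t / (1 - of_real k * t) ^ 2) ^ n
            * khyp k (lam + of_nat n * of_real k) (\<alpha> + of_nat n * of_real k) (\<beta> + of_nat n * of_real k)
                (x / (1 - of_real k * t))
            * khyp k (lam + of_nat n * of_real k) (\<gamma> + of_nat n * of_real k) (\<delta> + of_nat n * of_real k)
                (y / (1 - of_real k * t))) \<and>
        (\<lambda>n. kpoch k lam n / fact n
            * khyp k (lam + of_nat n * of_real k) \<alpha> \<beta> x
            * khyp k (lam + of_nat n * of_real k) \<gamma> \<delta> y * t ^ n)
        sums
        ((1 - of_real k * t) powr (- (lam / of_real k))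
          * (\<Sum>n. kpoch k lam n * kpoch k \<alpha> n * kpoch k \<gamma> n / (kpoch k \<beta> n * kpoch k \<delta> n * fact n)
            * (of_real k ^ 2 * x * y * t / (1 - of_real k * t) ^ 2) ^ n
            * khyp k (lam + of_nat n * of_real k) (\<alpha> + of_nat n * of_real k) (\<beta> + of_nat n * of_real k)
                (x / (1 - of_real k * t))
            * khyp k (lam + of_nat n * of_real k) (\<gamma> + of_nat n * of_real k) (\<delta> + of_nat n * of_real k)
                (y / (1 - of_real k * t)))))
     \<and>
     ((\<forall>m::nat. lam \<noteq> - (of_nat m * of_real k)) \<longrightarrow>
        (\<lambda>n. kpoch k lam n / fact n
            * khyp k (lam + of_nat n * of_real k) \<alpha> lam x
            * khyp k (lam + of_nat n * of_real k) \<gamma> lam y * t ^ n)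
        sums
        ((1 - of_real k * t) powr ((\<gamma> + \<alpha> - lam) / of_real k)
          * (1 - of_real k * t - of_real k * x) powr (- (\<alpha> / of_real k))
          * (1 - of_real k * t - of_real k * y) powr (- (\<gamma> / of_real k))
          * khyp k \<alpha> \<gamma> lam
              (of_real k ^ 2 * x * y * t
                / ((1 - of_real k * t - of_real k * x) * (1 - of_real k * t - of_real k * y)))))"
proof (intro conjI impI, goal_cases)
  case 1
  show ?case
    using khyp_product_generating(1)[OF k region, of lam \<alpha> \<beta> \<gamma> \<delta>]
    unfolding khyp_transformed_def[abs_def] .
next
  case 2
  show ?case
    using khyp_product_generating(2)[OF k region, of lam \<alpha> \<beta> \<gamma> \<delta>]
    unfolding khyp_transformed_def[abs_def] khyp_generating_def[abs_def] .
next
  case lam: 3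
  have "1 - of_real k * t \<noteq> 0" using conv_region_Re(1)[OF k region] by (metis less_irrefl zero_complex.simps(1))
  then have w: "(1 - of_real k * t) powr (- (lam / of_real k)) * (1 - of_real k * t) powr ((\<gamma> + \<alpha>) / of_real k)
     = (1 - of_real k * t) powr ((\<gamma> + \<alpha> - lam) / of_real k)"
    by (simp add: diff_divide_distrib powr_diff powr_minus field_simps)
  show ?case
    using khyp_product_generating(2)[OF k region, of lam \<alpha> lam \<gamma> lam]
    unfolding suminf_khyp_transformed_cancel[OF k region lam] khyp_generating_def[abs_def] w[symmetric]
    by (simp only: mult.assoc)
qed

end
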